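(* Let $p\in(0,1)$ be constant and $b=\frac{1}{1-p}$. Then asymptotically almost surely (i.e. with probability tending to $1$ as $n\to\infty$), \[ \mathrm{domhad}(G(n,p)) = (1+o(1))\frac{n}{\log_b n}. \]
   Context: $G(n,p)$ is the Erdős–Rényi random graph on $n$ vertices in which each edge is present independently with probability $p$. A dominating $K_t$-model in a graph $G$ is a sequence $(T_1,\dots,T_t)$ of pairwise disjoint non-empty connected subgraphs of $G$ such that for all $1\le i<j\le t$, every vertex of $T_j$ has a neighbour in $T_i$. The dominating Hadwiger number $\mathrm{domhad}(G)$ is the maximum integer $t$ such that $G$ contains a dominating $K_t$-model. *)

theory Defs
  imports "HOL-Probability.Probability" "Graph_Theory.Digraph_Component"
begin

text \<open>
  Simple graphs are the finite, loop-free, symmetric digraphs of \<^locale>\<open>pair_graph\<close>: an undirected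
  edge is represented by the two opposite arcs between its ends. Names that also exist in
  topology are qualified, so that connectedness is the graph-theoretic one.
\<close>

text \<open>The \<open>i\<close>-th subgraph of the sequence is \<open>Ts ! i\<close>, with indices starting from 0.\<close>

definition dominating_K_model ::
    "'a pair_pre_digraph \<Rightarrow> nat \<Rightarrow> 'a pair_pre_digraph list \<Rightarrow> bool" where
  "dominating_K_model G t Ts \<longleftrightarrow>
     length Ts = t \<and>
     (\<forall>T \<in> set Ts. pair_graph T \<and> subgraph (with_proj T) (with_proj G) \<and>
        pverts T \<noteq> {} \<and> Digraph_Component.connected (with_proj T)) \<and>
     (\<forall>i j. i < j \<and> j < t \<longrightarrow>
        pverts (Ts ! i) \<inter> pverts (Ts ! j) = {} \<and>
        (\<forall>v \<in> pverts (Ts ! j). \<exists>u \<in> pverts (Ts ! i). (u, v) \<in> parcs G))"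

definition domhad :: "'a pair_pre_digraph \<Rightarrow> nat" where
  "domhad G = Max {t. \<exists>Ts. dominating_K_model G t Ts}"

text \<open>The maximum is taken over a finite, non-empty set.\<close>

lemma finite_dominating_K_model_sizes:
  assumes "pair_graph G"
  shows "finite {t. \<exists>Ts. dominating_K_model G t Ts}"
proof (rule finite_subset)
  have fin: "finite (pverts G)"
    using assms by (simp add: pair_graph_def pair_digraph_def pair_fin_digraph_def
        pair_fin_digraph_axioms_def)
  show "{t. \<exists>Ts. dominating_K_model G t Ts} \<subseteq> {..card (pverts G)}"
  proof clarify
    fix t Ts assume M: "dominating_K_model G t Ts"
    have len: "length Ts = t" using M by (simp add: dominating_K_model_def)
    have sub: "pverts (Ts ! i) \<subseteq> pverts G" and ne: "pverts (Ts ! i) \<noteq> {}" if "i < t" for i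
      using M that nth_mem[of i Ts] by (auto simp: dominating_K_model_def subgraph_def)
    have disj: "pverts (Ts ! i) \<inter> pverts (Ts ! j) = {}" if "i < t" "j < t" "i \<noteq> j" for i j
      using M that unfolding dominating_K_model_def by (metis Int_commute nat_neq_iff)
    define f where "f i = (SOME v. v \<in> pverts (Ts ! i))" for i
    have f: "f i \<in> pverts (Ts ! i)" if "i < t" for i
      unfolding f_def using ne[OF that] by (simp add: some_in_eq)
    have "inj_on f {..<t}"
      by (rule inj_onI) (metis IntI disj empty_iff f lessThan_iff)
    moreover have "f ` {..<t} \<subseteq> pverts G" using f sub by auto
    ultimately show "t \<le> card (pverts G)"
      using card_inj_on_le[OF _ _ fin] by fastforce
  qed
qed simp

lemma dominating_K_model_0: "dominating_K_model G 0 []"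
  by (simp add: dominating_K_model_def)

definition graph_of_edges :: "nat \<Rightarrow> (nat set \<Rightarrow> bool) \<Rightarrow> nat pair_pre_digraph" where
  "graph_of_edges n X =
     \<lparr>pverts = {..<n}, parcs = {(u, v). u < n \<and> v < n \<and> u \<noteq> v \<and> X {u, v}}\<rparr>"

lemma pair_graph_graph_of_edges: "pair_graph (graph_of_edges n X)"
proof -
  have "finite {(u, v). u < n \<and> v < n \<and> u \<noteq> v \<and> X {u, v}}"
    by (rule finite_subset[of _ "{..<n} \<times> {..<n}"]) auto
  then show ?thesis
    by unfold_locales
      (auto simp: graph_of_edges_def symmetric_def insert_commute intro!: symI)
qed

text \<open>
  The Erdos-Renyi random graph on the vertex set \<open>{..<n}\<close>: independently for each 2-element
  vertex set, a Bernoulli variable with success probability \<open>p\<close> decides whether it is an edge.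
\<close>

definition gnp :: "nat \<Rightarrow> real \<Rightarrow> nat pair_pre_digraph pmf" where
  "gnp n p = map_pmf (graph_of_edges n)
     (Pi_pmf {e. e \<subseteq> {..<n} \<and> card e = 2} False (\<lambda>_. bernoulli_pmf p))"

end

theory Submission
  imports Defs "HOL-Real_Asymp.Real_Asymp"
begin

text \<open>
  Upper bound: in a model with more than \<open>(1 + \<epsilon>) n / log b n\<close> branch sets, some
  \<open>\<Omega>(n / log n)\<close> of them have at most \<open>\<theta> log b n\<close> vertices, where \<open>\<theta> < 1\<close>. Colour the
  vertices by the first \<open>h\<close> of these small sets and give one further colour to the union of the
  others; each of the first \<open>h\<close> colours dominates the last one. For a fixed colouring this involves
  \<open>h\<^sup>2\<close> independent events of probability at most \<open>1 - n powr (- \<theta>)\<close>, which beats the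
  \<open>(h + 2) ^ n\<close> colourings.

  Lower bound: cut the vertices into blocks of size \<open>\<theta> log b n\<close> with \<open>\<theta> > 1\<close>. With probability
  \<open>1 - o(1)\<close> a given block has diameter at most 2 and dominates all vertices outside it. By
  Markov's inequality all but a small proportion of the blocks have these properties, and any
  sequence of such blocks is a dominating model.
\<close>

section \<open>Independence of events on disjoint sets of coordinates\<close>

text \<open>This plays the role of measurability with respect to the coordinates in
  \<open>F\<close>, in a form that suits functions drawn from \<open>Pi_pmf\<close>.\<close>

definition determined_on :: "'e set \<Rightarrow> (('e \<Rightarrow> 'v) \<Rightarrow> bool) \<Rightarrow> bool" where
  "determined_on F Q \<longleftrightarrow> (\<forall>X Y. (\<forall>e\<in>F. X e = Y e) \<longrightarrow> Q X = Q Y)"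

lemma determined_onI:
  assumes "\<And>X Y. (\<And>e. e \<in> F \<Longrightarrow> X e = Y e) \<Longrightarrow> Q X \<Longrightarrow> Q Y"
  shows "determined_on F Q"
  unfolding determined_on_def using assms by metis

lemma determined_onD: "determined_on F Q \<Longrightarrow> (\<And>e. e \<in> F \<Longrightarrow> X e = Y e) \<Longrightarrow> Q X = Q Y"
  unfolding determined_on_def by blast

text \<open>The rule \<open>measure_pmf_prob_product\<close> asks for countable sets. Intersecting
  both factors with the supports provides them without changing any probability.\<close>

lemma prob_pair_pmf_Times:
  "measure_pmf.prob (pair_pmf M N) (A \<times> B) = measure_pmf.prob M A * measure_pmf.prob N B"
proof -
  have "measure_pmf.prob (pair_pmf M N) (A \<times> B) =
      measure_pmf.prob (pair_pmf M N) ((A \<inter> set_pmf M) \<times> (B \<inter> set_pmf N))"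
    by (subst measure_Int_set_pmf[symmetric]) (auto intro!: arg_cong[where f = "measure_pmf.prob _"])
  also have "\<dots> = measure_pmf.prob M (A \<inter> set_pmf M) * measure_pmf.prob N (B \<inter> set_pmf N)"
    by (rule measure_pmf_prob_product) (auto intro: countable_Int2)
  finally show ?thesis by (simp add: measure_Int_set_pmf)
qed

text \<open>A function on \<open>E\<close> is an independent pair of functions on \<open>F\<close>
  and on \<open>E - F\<close>. Since \<open>F'\<close> lies in \<open>E - F\<close>, the conjunction
  becomes a rectangle in this product.\<close>

lemma prob_Pi_pmf_conj:
  fixes P Q :: "('e \<Rightarrow> 'v) \<Rightarrow> bool"
  assumes E: "finite E" and F: "F \<subseteq> E" "F' \<subseteq> E" "F \<inter> F' = {}"
    and P: "determined_on F P" and Q: "determined_on F' Q"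
  shows "measure_pmf.prob (Pi_pmf E d D) {X. P X \<and> Q X} =
    measure_pmf.prob (Pi_pmf E d D) {X. P X} * measure_pmf.prob (Pi_pmf E d D) {X. Q X}"
proof -
  have split: "measure_pmf.prob (Pi_pmf E d D) {X. P' X \<and> Q' X} =
      measure_pmf.prob (Pi_pmf F d D) {X. P' X} * measure_pmf.prob (Pi_pmf (E - F) d D) {X. Q' X}"
    if "determined_on F P'" "determined_on F' Q'" for P' Q'
  proof -
    let ?h = "\<lambda>(f, g) x. if x \<in> F then f x else (g x :: 'v)"
    have "Pi_pmf E d D = map_pmf ?h (pair_pmf (Pi_pmf F d D) (Pi_pmf (E - F) d D))"
      using Pi_pmf_union[of F "E - F" d D] E F by (auto simp: Un_absorb1 intro: finite_subset)
    moreover have "P' (?h (f, g)) = P' f" "Q' (?h (f, g)) = Q' g" for f g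
      using F(3) by (auto intro!: determined_onD[OF that(1)] determined_onD[OF that(2)])
    then have "?h -` {X. P' X \<and> Q' X} = {X. P' X} \<times> {X. Q' X}" by auto
    ultimately show ?thesis by (simp add: prob_pair_pmf_Times)
  qed
  \<comment> \<open>The trivial event is determined on every set, so inserting it for either event
    in \<open>split\<close> yields the two single probabilities.\<close>
  have T: "determined_on F'' (\<lambda>_. True)" for F'' :: "'e set" by (simp add: determined_on_def)
  show ?thesis
    using split[OF P Q] split[OF P T] split[OF T Q] by simp
qed

text \<open>By induction one event is split off at a time. The conjunction of the others is
  determined on the union of their coordinate sets, which is disjoint from
  \<open>F a\<close>.\<close>

lemma prob_Pi_pmf_Ball:
  fixes Q :: "'i \<Rightarrow> ('e \<Rightarrow> 'v) \<Rightarrow> bool"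
  assumes "finite E" "finite A" and "\<And>a. a \<in> A \<Longrightarrow> F a \<subseteq> E" and "disjoint_family_on F A"
    and "\<And>a. a \<in> A \<Longrightarrow> determined_on (F a) (Q a)"
  shows "measure_pmf.prob (Pi_pmf E d D) {X. \<forall>a\<in>A. Q a X} =
    (\<Prod>a\<in>A. measure_pmf.prob (Pi_pmf E d D) {X. Q a X})"
  using assms(2-)
proof (induction A rule: finite_induct)
  case (insert a A)
  have "measure_pmf.prob (Pi_pmf E d D) {X. Q a X \<and> (\<forall>a\<in>A. Q a X)} =
      measure_pmf.prob (Pi_pmf E d D) {X. Q a X} *
      measure_pmf.prob (Pi_pmf E d D) {X. \<forall>a\<in>A. Q a X}"
  proof (rule prob_Pi_pmf_conj[where F = "F a" and F' = "\<Union>a\<in>A. F a"])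
    show "determined_on (\<Union>a\<in>A. F a) (\<lambda>X. \<forall>a\<in>A. Q a X)"
    proof (rule determined_onI, rule ballI)
      fix X Y x assume "\<And>e. e \<in> (\<Union>a\<in>A. F a) \<Longrightarrow> X e = Y e" "\<forall>a\<in>A. Q a X" "x \<in> A"
      then show "Q x Y" using determined_onD[OF insert.prems(3)[of x], of X Y] by auto
    qed
    show "F a \<inter> (\<Union>a\<in>A. F a) = {}"
      using insert.prems(2) insert.hyps(2) by (fastforce simp: disjoint_family_on_def)
  qed (use insert.prems assms(1) in auto)
  moreover have "disjoint_family_on F A"
    using insert.prems(2) by (rule disjoint_family_on_mono[rotated]) auto
  ultimately show ?case using insert by simp
qed simp

lemma prob_Pi_pmf_const:
  assumes "finite E" "F \<subseteq> E"
  shows "measure_pmf.prob (Pi_pmf E d (\<lambda>_. D)) {X. \<forall>e\<in>F. X e \<in> B} =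
    measure_pmf.prob D B ^ card F"
proof -
  have "measure_pmf.prob (Pi_pmf E d (\<lambda>_. D)) {X. \<forall>e\<in>F. X e \<in> B} =
      measure_pmf.prob (Pi_pmf E d (\<lambda>_. D)) (Pi E (\<lambda>e. if e \<in> F then B else UNIV))"
    using assms(2) by (auto intro!: arg_cong[where f = "measure_pmf.prob _"] split: if_splits)
  also have "\<dots> = (\<Prod>e\<in>E. if e \<in> F then measure_pmf.prob D B else 1)"
    by (subst measure_Pi_pmf_Pi[OF assms(1)]) (auto intro!: prod.cong)
  also have "\<dots> = (\<Prod>e\<in>F. measure_pmf.prob D B)"
    using assms by (simp add: prod.inter_restrict[symmetric] Int_absorb1)
  finally show ?thesis by simp
qed

section \<open>Random edges and models of maximum size\<close>

definition edges :: "nat \<Rightarrow> nat set set" where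
  "edges n = {e. e \<subseteq> {..<n} \<and> card e = 2}"

text \<open>All estimates are made for the edge indicators, where independence is available;
  \<open>gnp_eq\<close> transfers them to the random graph at the end.\<close>

definition edge_pmf :: "nat \<Rightarrow> real \<Rightarrow> (nat set \<Rightarrow> bool) pmf" where
  "edge_pmf n p = Pi_pmf (edges n) False (\<lambda>_. bernoulli_pmf p)"

lemma gnp_eq: "gnp n p = map_pmf (graph_of_edges n) (edge_pmf n p)"
  by (simp add: gnp_def edge_pmf_def edges_def)

lemma finite_edges: "finite (edges n)"
  by (simp add: edges_def)

lemma pair_in_edges [simp]: "{u, v} \<in> edges n \<longleftrightarrow> u < n \<and> v < n \<and> u \<noteq> v"
  by (auto simp: edges_def card_2_iff doubleton_eq_iff)

lemma prob_no_edge: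
  assumes "0 \<le> p" "p \<le> 1" "F \<subseteq> edges n"
  shows "measure_pmf.prob (edge_pmf n p) {X. \<forall>e\<in>F. \<not> X e} = (1 - p) ^ card F"
  using prob_Pi_pmf_const[OF finite_edges assms(3), of False "bernoulli_pmf p" "{False}"] assms
  by (simp add: edge_pmf_def measure_pmf_single)

lemma prob_all_edges:
  assumes "0 \<le> p" "p \<le> 1" "F \<subseteq> edges n"
  shows "measure_pmf.prob (edge_pmf n p) {X. \<forall>e\<in>F. X e} = p ^ card F"
  using prob_Pi_pmf_const[OF finite_edges assms(3), of False "bernoulli_pmf p" "{True}"] assms
  by (simp add: edge_pmf_def measure_pmf_single)

lemma prob_Collect_not:
  "measure_pmf.prob M {x. \<not> P x} = 1 - measure_pmf.prob M {x. P x}"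
  using measure_pmf.prob_compl[of "{x. P x}" M] by (simp add: Compl_eq[symmetric] Compl_eq_Diff_UNIV Collect_neg_eq)

lemma pverts_graph_of_edges [simp]: "pverts (graph_of_edges n X) = {..<n}"
  by (simp add: graph_of_edges_def)

lemma parcs_graph_of_edges [simp]:
  "(u, v) \<in> parcs (graph_of_edges n X) \<longleftrightarrow> u < n \<and> v < n \<and> u \<noteq> v \<and> X {u, v}"
  by (simp add: graph_of_edges_def)

lemma domhad_model:
  assumes "pair_graph G"
  obtains Ts where "dominating_K_model G (domhad G) Ts"
proof -
  have "domhad G \<in> {t. \<exists>Ts. dominating_K_model G t Ts}"
    unfolding domhad_def using finite_dominating_K_model_sizes[OF assms] dominating_K_model_0
    by (intro Max_in) auto
  then show thesis using that by auto
qed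

lemma domhad_ge:
  assumes "pair_graph G" "dominating_K_model G t Ts"
  shows "t \<le> domhad G"
  unfolding domhad_def using finite_dominating_K_model_sizes[OF assms(1)] assms(2)
  by (intro Max_ge) auto

section \<open>Upper bound: colourings extracted from large models\<close>

text \<open>Colour \<open>h + 1\<close> is left for the unused vertices.\<close>

definition dominating_colouring ::
    "nat \<Rightarrow> nat \<Rightarrow> nat \<Rightarrow> (nat set \<Rightarrow> bool) \<Rightarrow> (nat \<Rightarrow> nat) \<Rightarrow> bool" where
  "dominating_colouring n h k X c \<longleftrightarrow>
     (\<forall>i<h. card {u. u < n \<and> c u = i} \<le> k) \<and> h \<le> card {w. w < n \<and> c w = h} \<and>
     (\<forall>i<h. \<forall>w. w < n \<and> c w = h \<longrightarrow> (\<exists>u. u < n \<and> c u = i \<and> X {u, w}))"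

lemma card_large_sets_le:
  assumes "disjoint_family_on V I" "finite I" "\<And>i. i \<in> I \<Longrightarrow> V i \<subseteq> {..<n :: nat}"
    and "\<And>i. i \<in> I \<Longrightarrow> k < card (V i)"
  shows "card I \<le> n div Suc k"
proof -
  have "Suc k * card I = (\<Sum>i\<in>I. Suc k)" by simp
  also have "\<dots> \<le> (\<Sum>i\<in>I. card (V i))"
    using assms(4) by (intro sum_mono) (simp add: Suc_le_eq)
  also have "\<dots> = card (\<Union>i\<in>I. V i)"
    using assms finite_subset[OF assms(3)]
    by (intro card_UN_disjoint[symmetric]) (auto simp: disjoint_family_on_def)
  also have "\<dots> \<le> card {..<n}"
    using assms(3) by (intro card_mono) auto
  finally show ?thesis
    by (simp add: less_eq_div_iff_mult_less_eq mult.commute)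
qed

text \<open>By counting vertices, at most \<open>n div Suc k\<close> branch sets have more than
  \<open>k\<close> vertices, so at least \<open>2 * h\<close> small ones remain. The first
  \<open>h\<close> of them become the colours below \<open>h\<close>, and the union of all later
  small ones becomes colour \<open>h\<close>.\<close>

lemma domhad_imp_dominating_colouring:
  assumes "2 * h + n div Suc k \<le> domhad (graph_of_edges n X)"
  obtains c where "c \<in> {..<n} \<rightarrow>\<^sub>E {..Suc h}" "dominating_colouring n h k X c"
proof -
  define G where "G = graph_of_edges n X"
  define t where "t = domhad G"
  have pg: "pair_graph G" unfolding G_def by (rule pair_graph_graph_of_edges)
  obtain Ts where M: "dominating_K_model G t Ts"
    using domhad_model[OF pg] unfolding t_def by blast
  define V where "V i = pverts (Ts ! i)" for i
  have len: "length Ts = t" using M by (simp add: dominating_K_model_def)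
  have sub: "V i \<subseteq> {..<n}" and ne: "V i \<noteq> {}" if "i < t" for i
    using M that nth_mem[of i Ts]
    by (auto simp: dominating_K_model_def subgraph_def V_def G_def)
  have disj: "V i \<inter> V j = {}" if "i < t" "j < t" "i \<noteq> j" for i j
    using M that unfolding dominating_K_model_def V_def by (metis Int_commute nat_neq_iff)
  have dom: "\<exists>u \<in> V i. X {u, v}" if "i < j" "j < t" "v \<in> V j" for i j v
    using M that unfolding dominating_K_model_def V_def G_def by fastforce
  define small where "small = {i. i < t \<and> card (V i) \<le> k}"
  define xs where "xs = sorted_list_of_set small"
  have fin: "finite small" by (simp add: small_def)
  have "card {i. i < t \<and> k < card (V i)} \<le> n div Suc k"
    using sub disj by (intro card_large_sets_le[of V]) (auto simp: disjoint_family_on_def)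
  moreover have "card small + card {i. i < t \<and> k < card (V i)} = t"
  proof -
    have "card small + card {i. i < t \<and> k < card (V i)} = card (small \<union> {i. i < t \<and> k < card (V i)})"
      by (intro card_Un_disjoint[symmetric]) (auto simp: small_def)
    also have "small \<union> {i. i < t \<and> k < card (V i)} = {..<t}" by (auto simp: small_def)
    finally show ?thesis by simp
  qed
  ultimately have lxs: "2 * h \<le> length xs"
    using assms by (simp add: xs_def t_def G_def)
  have set_xs: "set xs = small" using fin by (simp add: xs_def)
  have xs: "xs ! j < t" "card (V (xs ! j)) \<le> k" if "j < length xs" for j
    using nth_mem[OF that] by (auto simp: set_xs small_def)
  \<comment> \<open>The small sets are listed in their order in the model, so an earlier set of the
    list dominates each later one.\<close>
  have mono: "xs ! i < xs ! j" if "i < j" "j < length xs" for i j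
    using that strict_sorted_list_of_set[of small] unfolding xs_def
    by (meson sorted_wrt_nth_less)
  define U where "U j = V (xs ! j)" for j
  have U: "U j \<subseteq> {..<n}" "U j \<noteq> {}" "card (U j) \<le> k" if "j < length xs" for j
    using that xs sub ne by (auto simp: U_def)
  have Udisj: "U i \<inter> U j = {}" if "i < length xs" "j < length xs" "i \<noteq> j" for i j
    using that disj[of "xs ! i" "xs ! j"] xs mono unfolding U_def
    by (metis less_irrefl_nat nat_neq_iff)
  have Udom: "\<exists>u \<in> U i. X {u, v}" if "i < j" "j < length xs" "v \<in> U j" for i j v
    using that dom[of "xs ! i" "xs ! j" v] xs mono by (auto simp: U_def)
  \<comment> \<open>At least \<open>h\<close> small sets are left for \<open>W\<close>. They are
    disjoint and non-empty, so \<open>W\<close> has at least \<open>h\<close> vertices.\<close>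
  define W where "W = (\<Union>j\<in>{h..<length xs}. U j)"
  \<comment> \<open>The index picked by \<open>SOME\<close> is unique because the sets
    \<open>U i\<close> are disjoint. Vertices of large branch sets get colour \<open>Suc h\<close>,
    like those outside the model.\<close>
  define c where "c = restrict (\<lambda>u. if \<exists>i<h. u \<in> U i then SOME i. i < h \<and> u \<in> U i
      else if u \<in> W then h else Suc h) {..<n}"
  have c_less: "c u < h \<and> u \<in> U (c u)" if "\<exists>i<h. u \<in> U i" "u < n" for u
    using that someI_ex[of "\<lambda>i. i < h \<and> u \<in> U i"] by (auto simp: c_def)
  have c_ge: "c u = (if u \<in> W then h else Suc h)" if "\<not> (\<exists>i<h. u \<in> U i)" "u < n" for u
    using that by (auto simp: c_def)
  have col_i: "{u. u < n \<and> c u = i} = U i" if "i < h" for i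
  proof (intro equalityI subsetI CollectI)
    fix u assume "u \<in> {u. u < n \<and> c u = i}"
    with that c_less[of u] c_ge[of u] show "u \<in> U i" by (cases "\<exists>i<h. u \<in> U i") (auto split: if_splits)
  next
    fix u assume u: "u \<in> U i"
    then have un: "u < n" using U(1)[of i] that lxs by auto
    with u that c_less[of u] have "c u < h" "u \<in> U (c u)" by auto
    then have "c u = i" using Udisj[of "c u" i] u that lxs by auto
    with un show "u < n \<and> c u = i" by simp
  qed
  have col_h: "{w. w < n \<and> c w = h} = W"
  proof (intro equalityI subsetI CollectI)
    fix u assume "u \<in> {w. w < n \<and> c w = h}"
    with c_less[of u] c_ge[of u] show "u \<in> W" by (cases "\<exists>i<h. u \<in> U i") (auto split: if_splits)
  next
    fix u assume u: "u \<in> W"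
    then obtain j where j: "h \<le> j" "j < length xs" "u \<in> U j" by (auto simp: W_def)
    then have "u < n" using U(1)[of j] by auto
    moreover have "\<not> (\<exists>i<h. u \<in> U i)"
    proof
      assume "\<exists>i<h. u \<in> U i"
      then obtain i where "i < h" "u \<in> U i" by blast
      then show False using Udisj[of i j] j lxs by auto
    qed
    ultimately show "u < n \<and> c u = h" using c_ge[of u] u by simp
  qed
  have "c \<in> {..<n} \<rightarrow>\<^sub>E {..Suc h}"
  proof (rule PiE_I)
    fix u assume "u \<in> {..<n}"
    then show "c u \<in> {..Suc h}"
      using c_less[of u] c_ge[of u] by (cases "\<exists>i<h. u \<in> U i") auto
  qed (simp add: c_def)
  moreover have "dominating_colouring n h k X c"
    unfolding dominating_colouring_def
  proof (intro conjI allI impI)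
    fix i assume "i < h"
    then show "card {u. u < n \<and> c u = i} \<le> k" using U(3)[of i] lxs by (simp add: col_i)
  next
    have "h \<le> (\<Sum>j\<in>{h..<length xs}. 1)" using lxs by simp
    also have "\<dots> \<le> (\<Sum>j\<in>{h..<length xs}. card (U j))"
      using U(1,2) finite_subset[OF U(1)]
      by (intro sum_mono) (auto simp: Suc_le_eq card_gt_0_iff)
    also have "\<dots> = card W"
      unfolding W_def using Udisj finite_subset[OF U(1)]
      by (intro card_UN_disjoint[symmetric]) auto
    finally show "h \<le> card {w. w < n \<and> c w = h}" by (simp add: col_h)
  next
    fix i w assume i: "i < h" and w: "w < n \<and> c w = h"
    then have "w \<in> W" using col_h by auto
    then obtain j where "h \<le> j" "j < length xs" "w \<in> U j" by (auto simp: W_def)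
    with i Udom[of i j w] obtain u where "u \<in> U i" "X {u, w}" by auto
    then show "\<exists>u. u < n \<and> c u = i \<and> X {u, w}" using col_i[OF i] by auto
  qed
  ultimately show thesis by (rule that)
qed

text \<open>For each colour \<open>i < h\<close> and each vertex \<open>w\<close> of colour
  \<open>h\<close>, some edge must join \<open>w\<close> to class \<open>i\<close>. That class has
  at most \<open>k\<close> vertices, so this fails with probability at least
  \<open>(1 - p) ^ k\<close>. There are at least \<open>h * h\<close> such pairs and their events
  are independent. If the class sizes are wrong, the event is empty.\<close>

lemma prob_dominating_colouring_le:
  assumes p: "0 \<le> p" "p \<le> 1"
  shows "measure_pmf.prob (edge_pmf n p) {X. dominating_colouring n h k X c}
    \<le> (1 - (1 - p) ^ k) ^ (h * h)" (is "?P \<le> ?r ^ _")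
proof -
  define S where "S i = {u. u < n \<and> c u = i}" for i
  have r: "0 \<le> ?r" "?r \<le> 1" using p by (auto simp: power_le_one)
  show ?thesis
  proof (cases "(\<forall>i<h. card (S i) \<le> k) \<and> h \<le> card (S h)")
    case False
    then have "{X. dominating_colouring n h k X c} = {}"
      by (auto simp: dominating_colouring_def S_def)
    then show ?thesis using r by simp
  next
    case True
    have finS: "finite (S i)" for i by (simp add: S_def)
    define F where "F = (\<lambda>(i, w). (\<lambda>u. {u, w}) ` S i)"
    let ?Q = "\<lambda>a X. \<exists>e\<in>F a. X e"
    let ?A = "{..<h} \<times> S h"
    have F: "F a \<subseteq> edges n" if "a \<in> ?A" for a using that by (auto simp: F_def S_def)
    have le: "measure_pmf.prob (edge_pmf n p) {X. ?Q a X} \<le> ?r" if A: "a \<in> ?A" for a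
    proof -
      obtain i w where a: "a = (i, w)" "i < h" using A by auto
      have "card (F a) \<le> k"
        using card_image_le[OF finS, of "\<lambda>u. {u, w}" i] True a by (auto simp: F_def intro: order_trans)
      then have "(1 - p) ^ k \<le> measure_pmf.prob (edge_pmf n p) {X. \<not> ?Q a X}"
        using prob_no_edge[OF p F[OF A]] p by (auto intro!: power_decreasing)
      then show ?thesis using prob_Collect_not[of "edge_pmf n p" "?Q a"] by simp
    qed
    have "?P \<le> measure_pmf.prob (edge_pmf n p) {X. \<forall>a\<in>?A. ?Q a X}"
      by (intro measure_pmf.finite_measure_mono)
         (auto simp: dominating_colouring_def F_def S_def)
    also have "\<dots> = (\<Prod>a\<in>?A. measure_pmf.prob (edge_pmf n p) {X. ?Q a X})"
      unfolding edge_pmf_def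
    proof (rule prob_Pi_pmf_Ball[where F = F])
      \<comment> \<open>An edge in \<open>F (i, w)\<close> has exactly one end of colour
        \<open>h\<close>, namely \<open>w\<close>, and the colour of its other end is
        \<open>i\<close>. Hence the edge determines the pair.\<close>
      show "disjoint_family_on F ?A"
        by (auto simp: disjoint_family_on_def F_def S_def doubleton_eq_iff)
    qed (use F finS finite_edges in \<open>auto simp: determined_on_def\<close>)
    also have "\<dots> \<le> (\<Prod>a\<in>?A. ?r)"
      using le by (intro prod_mono) auto
    also have "\<dots> = ?r ^ (h * card (S h))" by (simp add: card_cartesian_product)
    also have "\<dots> \<le> ?r ^ (h * h)"
      using True r by (intro power_decreasing) auto
    finally show ?thesis .
  qed
qed

text \<open>Union bound over the colourings of \<open>n\<close> vertices with the
  \<open>h + 2\<close> colours \<open>0, ..., h + 1\<close>.\<close>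

lemma prob_domhad_ge_le:
  assumes p: "0 \<le> p" "p \<le> 1"
  shows "measure_pmf.prob (edge_pmf n p) {X. 2 * h + n div Suc k \<le> domhad (graph_of_edges n X)}
    \<le> (real h + 2) ^ n * (1 - (1 - p) ^ k) ^ (h * h)"
proof -
  let ?C = "{..<n} \<rightarrow>\<^sub>E {..Suc h}"
  have fin: "finite ?C" by (intro finite_PiE) auto
  have "measure_pmf.prob (edge_pmf n p) {X. 2 * h + n div Suc k \<le> domhad (graph_of_edges n X)}
      \<le> measure_pmf.prob (edge_pmf n p) (\<Union>c\<in>?C. {X. dominating_colouring n h k X c})"
    by (intro measure_pmf.finite_measure_mono) (auto elim!: domhad_imp_dominating_colouring)
  also have "\<dots> \<le> (\<Sum>c\<in>?C. measure_pmf.prob (edge_pmf n p) {X. dominating_colouring n h k X c})"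
    using fin by (intro measure_pmf.finite_measure_subadditive_finite) auto
  also have "\<dots> \<le> (\<Sum>c\<in>?C. (1 - (1 - p) ^ k) ^ (h * h))"
    by (intro sum_mono prob_dominating_colouring_le p)
  also have "\<dots> = (real h + 2) ^ n * (1 - (1 - p) ^ k) ^ (h * h)"
    by (simp add: card_PiE add.commute)
  finally show ?thesis .
qed

section \<open>Lower bound: a set of suitable size is likely to be good\<close>

text \<open>Markov's inequality for the number of indices with \<open>B i\<close>, whose expectation
  is at most \<open>\<beta>\<close> times the number of indices by linearity.\<close>

lemma prob_ge_card_le:
  assumes "\<And>i. i \<in> I \<Longrightarrow> measure_pmf.prob M {x. B i x} \<le> \<beta>" and "finite I" "I \<noteq> {}" "0 < \<gamma>"
  shows "measure_pmf.prob M {x. \<gamma> * real (card I) \<le> real (card {i \<in> I. B i x})} \<le> \<beta> / \<gamma>"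
proof -
  let ?u = "\<lambda>x. \<Sum>i\<in>I. indicat_real {x. B i x} x"
  have u: "real (card {i \<in> I. B i x}) = ?u x" for x
    using assms(2) by (simp add: indicator_def sum.If_cases Int_def)
  have pos: "0 < real (card I)" using assms by (simp add: card_gt_0_iff)
  have int: "integrable (measure_pmf M) (indicat_real {x. B i x})" for i
    by (intro measure_pmf.integrable_const_bound[where B = 1]) auto
  have "measure_pmf.prob M {x. \<gamma> * real (card I) \<le> ?u x} \<le>
      measure_pmf.expectation M ?u / (\<gamma> * real (card I))"
    using integral_Markov_inequality_measure[of "measure_pmf M" ?u UNIV "\<gamma> * real (card I)"]
      int pos assms(4) by (simp add: sum_nonneg Bochner_Integration.integrable_sum)
  also have "measure_pmf.expectation M ?u = (\<Sum>i\<in>I. measure_pmf.prob M {x. B i x})"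
    using int by (subst Bochner_Integration.integral_sum) auto
  also have "\<dots> \<le> real (card I) * \<beta>"
    using assms(1) by (intro sum_bounded_above) auto
  finally show ?thesis using pos assms(4)
    by (simp add: u divide_right_mono field_simps)
qed

text \<open>
  Having pairwise common neighbours is a convenient reason for \<open>S\<close> to induce a connected graph.
\<close>

definition good :: "nat \<Rightarrow> (nat set \<Rightarrow> bool) \<Rightarrow> nat set \<Rightarrow> bool" where
  "good n X S \<longleftrightarrow>
     (\<forall>u\<in>S. \<forall>v\<in>S. u \<noteq> v \<longrightarrow> (\<exists>w\<in>S - {u, v}. X {u, w} \<and> X {v, w})) \<and>
     (\<forall>w\<in>{..<n} - S. \<exists>u\<in>S. X {u, w})"

text \<open>Union bound over the two kinds of failure: an outside vertex has no neighbour in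
  \<open>S\<close>, or an ordered pair of distinct vertices of \<open>S\<close> has no common
  neighbour among the other \<open>k - 2\<close>. There are at most \<open>n\<close> such vertices
  and \<open>k^2\<close> such pairs.\<close>

lemma prob_not_good_le:
  assumes p: "0 \<le> p" "p \<le> 1" and S: "S \<subseteq> {..<n}" "card S = k"
  shows "measure_pmf.prob (edge_pmf n p) {X. \<not> good n X S}
    \<le> real n * (1 - p) ^ k + (real k)\<^sup>2 * (1 - p\<^sup>2) ^ (k - 2)"
proof -
  define M where "M = edge_pmf n p"
  define A where "A w = {X. \<forall>u\<in>S. \<not> X {u, w}}" for w
  define B where "B = (\<lambda>(u, v). {X. \<forall>w\<in>S - {u, v}. \<not> (X {u, w} \<and> X {v, w})})"
  define D where "D = {(u, v). u \<in> S \<and> v \<in> S \<and> u \<noteq> v}"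
  have finS: "finite S" using S finite_subset by blast
  have D: "D \<subseteq> S \<times> S" by (auto simp: D_def)
  then have finD: "finite D" using finS finite_subset by blast
  have PA: "measure_pmf.prob M (A w) = (1 - p) ^ k" if "w \<in> {..<n} - S" for w
  proof -
    let ?F = "(\<lambda>u. {u, w}) ` S"
    have "?F \<subseteq> edges n" using S that by auto
    moreover have "card ?F = k"
      unfolding S(2)[symmetric] by (intro card_image) (auto simp: inj_on_def doubleton_eq_iff)
    ultimately show ?thesis using prob_no_edge[OF p, of ?F n] by (simp add: A_def M_def)
  qed
  have PB: "measure_pmf.prob M (B (u, v)) = (1 - p\<^sup>2) ^ (k - 2)" if "(u, v) \<in> D" for u v
  proof -
    let ?F = "\<lambda>w. {{u, w}, {v, w}}"
    have uv: "u \<in> S" "v \<in> S" "u \<noteq> v" using that by (auto simp: D_def)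
    have F: "?F w \<subseteq> edges n" if "w \<in> S - {u, v}" for w using that uv S by auto
    have one: "measure_pmf.prob M {X. \<not> (X {u, w} \<and> X {v, w})} = 1 - p\<^sup>2"
      if "w \<in> S - {u, v}" for w
      using prob_all_edges[OF p F[OF that]] uv
        prob_Collect_not[of M "\<lambda>X. X {u, w} \<and> X {v, w}"]
      by (simp add: M_def doubleton_eq_iff power2_eq_square)
    have "measure_pmf.prob M (B (u, v)) =
        (\<Prod>w\<in>S - {u, v}. measure_pmf.prob M {X. \<not> (X {u, w} \<and> X {v, w})})"
      unfolding B_def M_def edge_pmf_def prod.case
    proof (rule prob_Pi_pmf_Ball[where F = ?F])
      \<comment> \<open>Since \<open>w\<close> avoids \<open>u\<close> and \<open>v\<close>,
        different candidates \<open>w\<close> for a common neighbour use disjoint pairs of edges, so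
        their failures are independent.\<close>
      show "disjoint_family_on ?F (S - {u, v})"
        using uv by (auto simp: disjoint_family_on_def doubleton_eq_iff)
    qed (use F finS finite_edges in \<open>auto simp: determined_on_def\<close>)
    also have "\<dots> = (1 - p\<^sup>2) ^ card (S - {u, v})"
      using one by simp
    also have "card (S - {u, v}) = k - 2"
      using uv finS S by (simp add: card_Diff_subset)
    finally show ?thesis .
  qed
  then have PB': "measure_pmf.prob M (B x) = (1 - p\<^sup>2) ^ (k - 2)" if "x \<in> D" for x
    using that by (cases x) simp
  have "measure_pmf.prob M {X. \<not> good n X S} \<le>
      measure_pmf.prob M ((\<Union>w\<in>{..<n} - S. A w) \<union> (\<Union>x\<in>D. B x))"
    by (intro measure_pmf.finite_measure_mono) (auto simp: good_def A_def B_def D_def)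
  also have "\<dots> \<le> measure_pmf.prob M (\<Union>w\<in>{..<n} - S. A w) + measure_pmf.prob M (\<Union>x\<in>D. B x)"
    by (intro measure_Un_le) auto
  also have "\<dots> \<le> (\<Sum>w\<in>{..<n} - S. measure_pmf.prob M (A w)) + (\<Sum>x\<in>D. measure_pmf.prob M (B x))"
    using finD by (intro add_mono measure_pmf.finite_measure_subadditive_finite) auto
  also have "\<dots> = real (card ({..<n} - S)) * (1 - p) ^ k + real (card D) * (1 - p\<^sup>2) ^ (k - 2)"
    using PA PB' by simp
  also have "\<dots> \<le> real n * (1 - p) ^ k + (real k)\<^sup>2 * (1 - p\<^sup>2) ^ (k - 2)"
  proof (intro add_mono mult_right_mono)
    show "real (card ({..<n} - S)) \<le> real n"
      using card_mono[of "{..<n}" "{..<n} - S"] by simp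
    show "real (card D) \<le> (real k)\<^sup>2"
      using card_mono[OF _ D] finS S by (simp add: card_cartesian_product power2_eq_square flip: of_nat_mult)
  qed (use p in \<open>auto simp: power_le_one\<close>)
  finally show ?thesis by (simp add: M_def)
qed

section \<open>Models built from disjoint good blocks\<close>

definition induced :: "'a pair_pre_digraph \<Rightarrow> 'a set \<Rightarrow> 'a pair_pre_digraph" where
  "induced G S = \<lparr>pverts = S, parcs = parcs G \<inter> S \<times> S\<rparr>"

lemma pverts_induced [simp]: "pverts (induced G S) = S"
  and parcs_induced [simp]: "parcs (induced G S) = parcs G \<inter> S \<times> S"
  by (simp_all add: induced_def)

lemma pair_graph_induced:
  assumes "pair_graph G" "S \<subseteq> pverts G"
  shows "pair_graph (induced G S)" "subgraph (with_proj (induced G S)) (with_proj G)"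
proof -
  interpret pair_graph G by fact
  have fin: "finite S" using pair_finite_verts assms(2) finite_subset by blast
  show I: "pair_graph (induced G S)"
    using fin pair_finite_arcs arcs_symmetric no_loops'
    by unfold_locales (auto simp: symmetric_def intro!: symI)
  show "subgraph (with_proj (induced G S)) (with_proj G)"
    using assms(2) I pair_wf_digraph
    by (auto simp: subgraph_def wf_digraph_wp_iff compatible_def pair_graph_def pair_digraph_def
        pair_fin_digraph_def)
qed

lemma good_imp_connected:
  assumes "good n X S" "S \<subseteq> {..<n}" "S \<noteq> {}"
  shows "Digraph_Component.connected (with_proj (induced (graph_of_edges n X) S))"
proof -
  let ?H = "induced (graph_of_edges n X) S"
  interpret pair_graph ?H
    using assms(2) by (intro pair_graph_induced pair_graph_graph_of_edges) simp
  have "u \<rightarrow>\<^sup>*\<^bsub>with_proj ?H\<^esub> v" if uv: "u \<in> S" "v \<in> S" for u v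
  proof (cases "u = v")
    case True
    then show ?thesis using uv by (simp add: reachable_refl)
  next
    case False
    then obtain w where w: "w \<in> S" "w \<noteq> u" "w \<noteq> v" "X {u, w}" "X {v, w}"
      using assms(1) uv unfolding good_def by blast
    then have "(u, w) \<in> parcs ?H" "(w, v) \<in> parcs ?H"
      using uv assms(2) by (auto simp: insert_commute)
    then show ?thesis using adj_reachable_trans reachable_adjI by blast
  qed
  \<comment> \<open>Connectedness is strong connectedness of the symmetric closure, to which the
    paths of length two found in \<open>?H\<close> carry over.\<close>
  then show ?thesis
    using assms(3) reachable_mk_symmetricI
    by (simp add: Digraph_Component.connected_def strongly_connected_def)
qed

text \<open>A good set dominates every vertex outside it, in particular all sets disjoint from it.
  The subgraphs induced by the sets therefore form a model in the given order.\<close>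

lemma length_good_le_domhad:
  assumes "\<And>S. S \<in> set Ss \<Longrightarrow> S \<subseteq> {..<n} \<and> S \<noteq> {} \<and> good n X S"
    and "\<And>i j. i < j \<Longrightarrow> j < length Ss \<Longrightarrow> Ss ! i \<inter> Ss ! j = {}"
  shows "length Ss \<le> domhad (graph_of_edges n X)"
proof (rule domhad_ge[OF pair_graph_graph_of_edges])
  let ?G = "graph_of_edges n X"
  show "dominating_K_model ?G (length Ss) (map (induced ?G) Ss)"
    unfolding dominating_K_model_def
  proof (intro conjI ballI allI impI; (elim conjE)?)
    fix T assume "T \<in> set (map (induced ?G) Ss)"
    then obtain S where S: "S \<in> set Ss" "T = induced ?G S" by auto
    note S' = assms(1)[OF S(1)]
    show "pair_graph T" "subgraph (with_proj T) (with_proj ?G)"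
      unfolding S(2) using S' by (intro pair_graph_induced pair_graph_graph_of_edges; simp)+
    show "pverts T \<noteq> {}" "Digraph_Component.connected (with_proj T)"
      using S' by (simp_all add: S(2) good_imp_connected)
  next
    fix i j assume ij: "i < j" "j < length Ss"
    then show "pverts (map (induced ?G) Ss ! i) \<inter> pverts (map (induced ?G) Ss ! j) = {}"
      using assms(2) by simp
    fix v assume "v \<in> pverts (map (induced ?G) Ss ! j)"
    then have v: "v \<in> Ss ! j" using ij by simp
    have "v \<in> {..<n} - Ss ! i" using v ij assms(1)[of "Ss ! j"] assms(2)[of i j] by auto
    moreover have "good n X (Ss ! i)" using ij assms(1)[of "Ss ! i"] by simp
    ultimately obtain u where u: "u \<in> Ss ! i" "X {u, v}" unfolding good_def by blast
    have "u < n" "u \<noteq> v"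
      using u ij v assms(1)[of "Ss ! i"] assms(2)[of i j] by auto
    with u show "\<exists>u\<in>pverts (map (induced ?G) Ss ! i). (u, v) \<in> parcs ?G"
      using ij v assms(1)[of "Ss ! j"] by auto
  qed simp
qed

text \<open>The blocks are consecutive intervals of length \<open>k\<close>; fewer than
  \<open>k\<close> vertices at the end belong to none. Distinct blocks are disjoint, so the good
  ones form a model.\<close>

lemma card_good_blocks_le_domhad:
  assumes "0 < k"
  shows "card {i \<in> {..<n div k}. good n X {i * k..<Suc i * k}} \<le> domhad (graph_of_edges n X)"
proof -
  let ?T = "\<lambda>i. {i * k..<Suc i * k}"
  define xs where "xs = filter (\<lambda>i. good n X (?T i)) [0..<n div k]"
  have "length (map ?T xs) \<le> domhad (graph_of_edges n X)"
  proof (rule length_good_le_domhad)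
    fix S assume "S \<in> set (map ?T xs)"
    then obtain i where i: "i < n div k" "good n X (?T i)" "S = ?T i" by (auto simp: xs_def)
    have "Suc i * k \<le> n div k * k" using i(1) by (intro mult_le_mono1) simp
    also have "\<dots> \<le> n" by simp
    finally show "S \<subseteq> {..<n} \<and> S \<noteq> {} \<and> good n X S"
      using i assms by auto
  next
    fix i j assume ij: "i < j" "j < length (map ?T xs)"
    have "sorted_wrt (<) xs" unfolding xs_def by (intro sorted_wrt_filter) simp
    then have "xs ! i < xs ! j" using ij by (simp add: sorted_wrt_nth_less)
    then have "Suc (xs ! i) * k \<le> xs ! j * k" by (intro mult_le_mono1) simp
    then show "map ?T xs ! i \<inter> map ?T xs ! j = {}" using ij by auto
  qed
  also have "length (map ?T xs) = card {i \<in> {..<n div k}. good n X (?T i)}"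
  proof -
    have "distinct xs" by (simp add: xs_def)
    then have "length (map ?T xs) = card (set xs)" by (simp add: distinct_card)
    then show ?thesis by (simp add: xs_def conj_commute)
  qed
  finally show ?thesis .
qed

text \<open>If \<open>domhad\<close> is this small, at least a share \<open>\<gamma>\<close> of the
  \<open>n div k\<close> blocks is not good, and Markov's inequality applies to the number of such
  blocks.\<close>

lemma prob_domhad_le_le:
  assumes p: "0 \<le> p" "p \<le> 1" and k: "0 < k" "k \<le> n" and "0 < \<gamma>"
  shows "measure_pmf.prob (edge_pmf n p)
      {X. real (domhad (graph_of_edges n X)) \<le> (1 - \<gamma>) * real (n div k)}
    \<le> (real n * (1 - p) ^ k + (real k)\<^sup>2 * (1 - p\<^sup>2) ^ (k - 2)) / \<gamma>" (is "_ \<le> ?\<beta> / _")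
proof -
  let ?T = "\<lambda>i. {i * k..<Suc i * k}" and ?I = "{..<n div k}"
  have "measure_pmf.prob (edge_pmf n p)
        {X. real (domhad (graph_of_edges n X)) \<le> (1 - \<gamma>) * real (n div k)}
      \<le> measure_pmf.prob (edge_pmf n p)
        {X. \<gamma> * real (card ?I) \<le> real (card {i \<in> ?I. \<not> good n X (?T i)})}"
  proof (intro measure_pmf.finite_measure_mono Collect_mono impI)
    fix X assume le: "real (domhad (graph_of_edges n X)) \<le> (1 - \<gamma>) * real (n div k)"
    have "card {i \<in> ?I. good n X (?T i)} + card {i \<in> ?I. \<not> good n X (?T i)} = card ?I"
    proof -
      have "?I = {i \<in> ?I. good n X (?T i)} \<union> {i \<in> ?I. \<not> good n X (?T i)}" by auto
      then show ?thesis by (subst (3) \<open>?I = _\<close>, intro card_Un_disjoint[symmetric]) auto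
    qed
    with card_good_blocks_le_domhad[OF k(1), of n X] le
    show "\<gamma> * real (card ?I) \<le> real (card {i \<in> ?I. \<not> good n X (?T i)})"
      by (simp add: algebra_simps)
  qed simp
  also have "\<dots> \<le> ?\<beta> / \<gamma>"
  proof (rule prob_ge_card_le)
    fix i assume "i \<in> ?I"
    then have "Suc i * k \<le> n div k * k" by (intro mult_le_mono1) simp
    also have "\<dots> \<le> n" by simp
    finally show "measure_pmf.prob (edge_pmf n p) {X. \<not> good n X (?T i)} \<le> ?\<beta>"
      by (intro prob_not_good_le p) auto
  next
    show "?I \<noteq> {}" using k by (simp add: lessThan_empty_iff bot_nat_def div_eq_0_iff)
  qed (use \<open>0 < \<gamma>\<close> in auto)
  finally show ?thesis .
qed

section \<open>Asymptotics of the two tails\<close>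

lemma domhad_upper_tail:
  assumes p: "0 < p" "p < 1" and b: "b = 1 / (1 - p)" and eps: "0 < \<epsilon>"
  shows "(\<lambda>n. measure_pmf.prob (edge_pmf n p)
    {X. (1 + \<epsilon>) * (real n / log b (real n)) < real (domhad (graph_of_edges n X))}) \<longlonglongrightarrow> 0"
proof -
  \<comment> \<open>With this choice 1 / \<theta> = 1 + \<epsilon> / 2, so the large branch sets
    account for at most (1 + \<epsilon> / 2) n / L. The remaining \<epsilon> / 2 is available for
    \<open>2 * h\<close>.\<close>
  define \<theta> where "\<theta> = 2 / (2 + \<epsilon>)"
  \<comment> \<open>Here c n / ln n is half of (\<epsilon> / 4) n / L. This leaves room for rounding
    down: \<open>h n\<close> is at least c n / ln n once that quantity is at least 1.\<close>
  define c where "c = \<epsilon> * ln b / 8"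
  have b1: "1 < b" using p by (simp add: b)
  have \<theta>: "0 < \<theta>" "\<theta> < 1" "1 / \<theta> = 1 + \<epsilon> / 2" using eps by (auto simp: \<theta>_def field_simps)
  have c: "0 < c" using b1 eps by (simp add: c_def)
  define L where "L n = log b (real n)" for n
  define h where "h n = nat \<lfloor>\<epsilon> / 4 * (real n / L n)\<rfloor>" for n
  define k where "k n = nat \<lfloor>\<theta> * L n\<rfloor>" for n
  define B where "B n = exp (real n * ln (real n) - real n powr (- \<theta>) * (c * real n / ln (real n))\<^sup>2)" for n
  \<comment> \<open>The subtracted term has order n^(2 - \<theta>) / (ln n)^2, which outgrows n ln n
    because \<theta> < 1.\<close>
  have B: "B \<longlonglongrightarrow> 0"
    unfolding B_def using \<theta> c by real_asymp
  have "\<forall>\<^sub>F n in sequentially. 2 * c * real n / ln (real n) + 2 \<le> real n"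
    using c by real_asymp
  moreover have "\<forall>\<^sub>F n in sequentially. 1 \<le> c * real n / ln (real n)"
    using c by real_asymp
  ultimately have "\<forall>\<^sub>F n in sequentially. measure_pmf.prob (edge_pmf n p)
    {X. (1 + \<epsilon>) * (real n / L n) < real (domhad (graph_of_edges n X))} \<le> B n"
    using eventually_gt_at_top[of 2]
  proof eventually_elim
    case (elim n)
    let ?x = "\<epsilon> / 4 * (real n / L n)"
    have L: "0 < L n" using elim b1 by (simp add: L_def)
    have x: "?x = 2 * (c * real n / ln (real n))"
      using b1 elim by (simp add: L_def log_def c_def field_simps)
    have x2: "2 \<le> ?x" unfolding x using elim(2) by linarith
    have h: "real (h n) \<le> ?x" "?x - 1 < real (h n)" using x2 by (auto simp: h_def)
    have h2: "real (h n) + 2 \<le> real n" using h elim(1) unfolding x by simp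
    have h3: "c * real n / ln (real n) \<le> real (h n)" using h(2) x2 unfolding x by linarith
    have k: "real (k n) \<le> \<theta> * L n" "\<theta> * L n < real (Suc (k n))"
      using L \<theta> by (auto simp: k_def) linarith
    have qk: "real n powr (- \<theta>) \<le> (1 - p) ^ k n"
    proof -
      have "real n powr (- \<theta>) = (1 - p) powr (\<theta> * L n)"
        using p b1 elim by (simp add: powr_def L_def log_def b ln_div)
      also have "\<dots> \<le> (1 - p) powr real (k n)"
        using k(1) p by (intro powr_mono') auto
      finally show ?thesis using p by (simp add: powr_realpow)
    qed
    have div: "real (n div Suc (k n)) \<le> (1 + \<epsilon> / 2) * (real n / L n)"
    proof -
      have "real (n div Suc (k n)) \<le> real n / real (Suc (k n))" by (rule of_nat_div_le_of_nat)
      also have "\<dots> \<le> real n / (\<theta> * L n)"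
        using k(2) L \<theta> by (intro divide_left_mono) auto
      also have "\<dots> = (1 / \<theta>) * (real n / L n)" by simp
      finally show ?thesis unfolding \<theta>(3) .
    qed
    have "measure_pmf.prob (edge_pmf n p)
        {X. (1 + \<epsilon>) * (real n / L n) < real (domhad (graph_of_edges n X))}
      \<le> measure_pmf.prob (edge_pmf n p) {X. 2 * h n + n div Suc (k n) \<le> domhad (graph_of_edges n X)}"
    proof (intro measure_pmf.finite_measure_mono Collect_mono impI)
      fix X assume "(1 + \<epsilon>) * (real n / L n) < real (domhad (graph_of_edges n X))"
      moreover have "real (2 * h n + n div Suc (k n)) \<le> (1 + \<epsilon>) * (real n / L n)"
        using h(1) div
        by (simp only: of_nat_add of_nat_mult of_nat_numeral distrib_right)
      ultimately show "2 * h n + n div Suc (k n) \<le> domhad (graph_of_edges n X)" by linarith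
    qed simp
    also have "\<dots> \<le> (real (h n) + 2) ^ n * (1 - (1 - p) ^ k n) ^ (h n * h n)"
      using p by (intro prob_domhad_ge_le) auto
    \<comment> \<open>As h + 2 \<le> n, the number of colourings is at most n^n. The other factor is
      bounded by 1 - x \<le> exp(-x) with x = n^(-\<theta>).\<close>
    also have "\<dots> \<le> exp (real n * ln (real n)) *
        exp (- (real n powr (- \<theta>) * (c * real n / ln (real n))\<^sup>2))"
    proof (intro mult_mono)
      have "(real (h n) + 2) ^ n \<le> real n ^ n" using h2 by (intro power_mono) auto
      then show "(real (h n) + 2) ^ n \<le> exp (real n * ln (real n))"
        using elim by (simp add: exp_of_nat_mult)
      have "(1 - (1 - p) ^ k n) ^ (h n * h n) \<le> exp (- (real n powr (- \<theta>))) ^ (h n * h n)"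
      proof (intro power_mono)
        show "1 - (1 - p) ^ k n \<le> exp (- (real n powr (- \<theta>)))"
          using qk exp_ge_add_one_self[of "- (real n powr (- \<theta>))"] by linarith
      qed (use p in \<open>simp add: power_le_one\<close>)
      also have "\<dots> = exp (- (real n powr (- \<theta>) * (real (h n))\<^sup>2))"
        by (simp add: exp_of_nat_mult[symmetric] power2_eq_square algebra_simps)
      also have "\<dots> \<le> exp (- (real n powr (- \<theta>) * (c * real n / ln (real n))\<^sup>2))"
        using h3 c elim by (auto intro!: mult_left_mono power_mono)
      finally show "(1 - (1 - p) ^ k n) ^ (h n * h n)
        \<le> exp (- (real n powr (- \<theta>) * (c * real n / ln (real n))\<^sup>2))" .
    qed (use p in \<open>auto simp: power_le_one\<close>)
    also have "\<dots> = B n" by (simp add: B_def exp_add[symmetric])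
    finally show ?case .
  qed
  then show ?thesis
    unfolding L_def by (intro tendsto_sandwich[OF _ _ tendsto_const B]) auto
qed

lemma domhad_lower_tail:
  assumes p: "0 < p" "p < 1" and b: "b = 1 / (1 - p)" and eps: "0 < \<epsilon>" "\<epsilon> \<le> 1"
  shows "(\<lambda>n. measure_pmf.prob (edge_pmf n p)
    {X. real (domhad (graph_of_edges n X)) < (1 - \<epsilon>) * (real n / log b (real n))}) \<longlonglongrightarrow> 0"
proof -
  \<comment> \<open>Since \<theta> > 1, the expected number of vertices that a block fails to
    dominate is at most n^(1 - \<theta>), which vanishes. The losses from \<theta> and \<gamma>
    together stay below \<epsilon>: (1 - \<epsilon>)(1 + \<epsilon> / 4) < 1 - \<epsilon> /
    2.\<close>
  define \<theta> where "\<theta> = 1 + \<epsilon> / 4"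
  define \<gamma> where "\<gamma> = \<epsilon> / 2"
  define l where "l = ln b"
  have b1: "1 < b" using p by (simp add: b)
  have l: "0 < l" using b1 by (simp add: l_def)
  have \<theta>: "1 < \<theta>" using eps by (auto simp: \<theta>_def)
  have \<gamma>: "0 < \<gamma>" "\<gamma> < 1" using eps by (auto simp: \<gamma>_def)
  have \<gamma>\<theta>: "1 - \<epsilon> < (1 - \<gamma>) / \<theta>"
    using eps by (simp add: \<gamma>_def \<theta>_def field_simps add_pos_pos)
  define L where "L n = ln (real n) / l" for n
  define k where "k n = nat \<lceil>\<theta> * L n\<rceil>" for n
  define r where "r = 1 - p\<^sup>2"
  have r: "0 < r" "r < 1" using p by (auto simp: r_def power_less_one_iff)
  have k_top: "filterlim k at_top sequentially"
  proof -
    have "filterlim (\<lambda>n. \<theta> * (ln (real n) / l)) at_top sequentially" using \<theta> l by real_asymp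
    then have "filterlim (\<lambda>n. real (k n)) at_top sequentially"
      by (rule filterlim_at_top_mono) (simp add: k_def L_def real_nat_ceiling_ge)
    then show ?thesis by (simp add: filterlim_sequentially_iff_filterlim_real)
  qed
  \<comment> \<open>The index is shifted by 2 so that the truncated subtraction \<open>j - 2\<close>
    becomes exact before the limit is taken.\<close>
  have "(\<lambda>j. (real j + 2)\<^sup>2 * r ^ j) \<longlonglongrightarrow> 0" using r by real_asymp
  then have "(\<lambda>j. (real (j + 2))\<^sup>2 * r ^ (j + 2 - 2)) \<longlonglongrightarrow> 0" by (simp add: add.commute)
  then have "(\<lambda>j. (real j)\<^sup>2 * r ^ (j - 2)) \<longlonglongrightarrow> 0" by (rule LIMSEQ_offset)
  then have lim2: "(\<lambda>n. (real (k n))\<^sup>2 * r ^ (k n - 2)) \<longlonglongrightarrow> 0"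
    using k_top by (rule filterlim_compose)
  define B where "B n = (real n * real n powr (- \<theta>) + (real (k n))\<^sup>2 * r ^ (k n - 2)) / \<gamma>" for n
  have "(\<lambda>n. real n * real n powr (- \<theta>)) \<longlonglongrightarrow> 0" using \<theta> by real_asymp
  then have B: "B \<longlonglongrightarrow> 0" unfolding B_def
    using tendsto_divide[OF tendsto_add[OF _ lim2] tendsto_const[of \<gamma>]] \<gamma> by fastforce
  have "\<forall>\<^sub>F n in sequentially. \<theta> * L n + 1 \<le> real n"
    unfolding L_def using \<theta> l by real_asymp
  \<comment> \<open>The \<open>+ 1\<close> and \<open>- 1\<close> pay for the ceiling in
    \<open>k n\<close> and the rounding in \<open>n div k n\<close>. Neither affects the limiting
    ratio (1 - \<gamma>) / \<theta>, which exceeds 1 - \<epsilon>.\<close>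
  moreover have "\<forall>\<^sub>F n in sequentially.
      (1 - \<epsilon>) * (real n / L n) < (1 - \<gamma>) * (real n / (\<theta> * L n + 1) - 1)"
  proof -
    have "(\<lambda>n. (1 - \<gamma>) * (real n / (\<theta> * L n + 1) - 1) / (real n / L n)) \<longlonglongrightarrow> (1 - \<gamma>) / \<theta>"
      unfolding L_def using \<theta> l \<gamma> by (real_asymp simp: field_simps)
    then have "\<forall>\<^sub>F n in sequentially. 1 - \<epsilon> < (1 - \<gamma>) * (real n / (\<theta> * L n + 1) - 1) / (real n / L n)"
      using \<gamma>\<theta> by (rule order_tendstoD)
    then show ?thesis using eventually_gt_at_top[of 1]
    proof eventually_elim
      case (elim n)
      then have pos: "0 < real n / L n" using l by (simp add: L_def)
      from elim(1) show ?case unfolding pos_less_divide_eq[OF pos] .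
    qed
  qed
  ultimately have "\<forall>\<^sub>F n in sequentially. measure_pmf.prob (edge_pmf n p)
    {X. real (domhad (graph_of_edges n X)) < (1 - \<epsilon>) * (real n / L n)} \<le> B n"
    using eventually_gt_at_top[of 1]
  proof eventually_elim
    case (elim n)
    have L: "0 < L n" using elim l by (simp add: L_def)
    then have "0 < \<theta> * L n" using \<theta> by simp
    then have k: "0 < k n" "\<theta> * L n \<le> real (k n)" "real (k n) < \<theta> * L n + 1"
      unfolding k_def by (auto simp: of_nat_ceiling) linarith+
    have kn: "k n \<le> n" using k(3) elim(1) by linarith
    have qk: "(1 - p) ^ k n \<le> real n powr (- \<theta>)"
    proof -
      have "(1 - p) ^ k n = (1 - p) powr real (k n)" using p by (simp add: powr_realpow)
      also have "\<dots> \<le> (1 - p) powr (\<theta> * L n)"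
        using k(2) p by (intro powr_mono') auto
      also have "\<dots> = real n powr (- \<theta>)"
        using p l elim by (simp add: powr_def L_def l_def b ln_div)
      finally show ?thesis .
    qed
    have div: "real n / (\<theta> * L n + 1) - 1 \<le> real (n div k n)"
    proof -
      have "real n / (\<theta> * L n + 1) \<le> real n / real (k n)"
        using k by (intro divide_left_mono) auto
      also have "\<dots> \<le> real (n div k n) + 1"
      proof -
        have "n \<le> k n + n div k n * k n" using dividend_less_div_times[OF k(1), of n] by simp
        then have "real n \<le> real (k n + n div k n * k n)" by (rule of_nat_mono)
        then show ?thesis using k(1) by (simp add: pos_divide_le_eq algebra_simps)
      qed
      finally show ?thesis by simp
    qed
    have "measure_pmf.prob (edge_pmf n p)
        {X. real (domhad (graph_of_edges n X)) < (1 - \<epsilon>) * (real n / L n)}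
      \<le> measure_pmf.prob (edge_pmf n p)
        {X. real (domhad (graph_of_edges n X)) \<le> (1 - \<gamma>) * real (n div k n)}"
    proof (intro measure_pmf.finite_measure_mono Collect_mono impI)
      fix X assume "real (domhad (graph_of_edges n X)) < (1 - \<epsilon>) * (real n / L n)"
      also note elim(2)
      also have "(1 - \<gamma>) * (real n / (\<theta> * L n + 1) - 1) \<le> (1 - \<gamma>) * real (n div k n)"
        using div \<gamma> by (intro mult_left_mono) auto
      finally show "real (domhad (graph_of_edges n X)) \<le> (1 - \<gamma>) * real (n div k n)" by simp
    qed simp
    also have "\<dots> \<le> (real n * (1 - p) ^ k n + (real (k n))\<^sup>2 * (1 - p\<^sup>2) ^ (k n - 2)) / \<gamma>"
      using p k kn \<gamma> by (intro prob_domhad_le_le) auto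
    also have "\<dots> \<le> B n"
      unfolding B_def r_def using qk \<gamma>
      by (intro divide_right_mono add_mono mult_left_mono) auto
    finally show ?case .
  qed
  then show ?thesis
    unfolding L_def l_def log_def[symmetric]
    by (intro tendsto_sandwich[OF _ _ tendsto_const B]) auto
qed

section \<open>From every fixed error to a vanishing error\<close>

text \<open>Diagonal argument: at \<open>n\<close> the error is 1 / (j + 1) for the largest j \<le>
  n at which \<open>P n\<close> is within 1 / (j + 1) of 1. Each fixed j eventually meets this
  condition, so the chosen j tends to infinity.\<close>

lemma diagonal_tendsto:
  fixes P :: "nat \<Rightarrow> real \<Rightarrow> real"
  assumes lim: "\<And>\<epsilon>. 0 < \<epsilon> \<Longrightarrow> \<epsilon> \<le> 1 \<Longrightarrow> (\<lambda>n. P n \<epsilon>) \<longlonglongrightarrow> 1"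
    and bounds: "\<And>n \<epsilon>. 0 \<le> P n \<epsilon>" "\<And>n \<epsilon>. P n \<epsilon> \<le> 1"
  obtains \<delta> where "\<delta> \<longlonglongrightarrow> 0" "(\<lambda>n. P n (\<delta> n)) \<longlonglongrightarrow> 1"
proof -
  define A where "A n = {j. j \<le> n \<and> 1 - 1 / real (Suc j) \<le> P n (1 / real (Suc j))}" for n
  define j where "j n = Max (A n)" for n
  define \<delta> where "\<delta> n = 1 / real (Suc (j n))" for n
  have fin: "finite (A n)" for n
    by (rule finite_subset[of _ "{..n}"]) (auto simp: A_def)
  \<comment> \<open>For j = 0 the condition reads 0 \<le> P n 1, so the maximum is always taken over
    a non-empty set.\<close>
  have "0 \<in> A n" for n using bounds by (simp add: A_def)
  then have jA: "j n \<in> A n" for n unfolding j_def using fin by (intro Max_in) auto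
  have "filterlim j at_top sequentially"
    unfolding filterlim_at_top
  proof
    fix J :: nat
    have "(\<lambda>n. P n (1 / real (Suc J))) \<longlonglongrightarrow> 1" by (intro lim) auto
    then have "\<forall>\<^sub>F n in sequentially. 1 - 1 / real (Suc J) < P n (1 / real (Suc J))"
      by (rule order_tendstoD) simp
    then show "\<forall>\<^sub>F n in sequentially. J \<le> j n"
      using eventually_ge_at_top[of J]
    proof eventually_elim
      case (elim n)
      then have "J \<in> A n" by (simp add: A_def)
      then show ?case unfolding j_def using fin by simp
    qed
  qed
  then have \<delta>: "\<delta> \<longlonglongrightarrow> 0"
    unfolding \<delta>_def using filterlim_compose[OF LIMSEQ_inverse_real_of_nat]
    by (simp add: inverse_eq_divide)
  have "(\<lambda>n. P n (\<delta> n)) \<longlonglongrightarrow> 1"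
  proof (rule tendsto_sandwich)
    show "\<forall>\<^sub>F n in sequentially. 1 - \<delta> n \<le> P n (\<delta> n)"
      using jA by (simp add: A_def \<delta>_def)
    show "(\<lambda>n. 1 - \<delta> n) \<longlonglongrightarrow> 1" using tendsto_diff[OF tendsto_const[of 1] \<delta>] by simp
  qed (use bounds in auto)
  with \<delta> show thesis by (rule that)
qed

text \<open>The o(1) is rendered by one deterministic null sequence \<open>\<delta>\<close> that
  bounds the relative error, while the error \<epsilon> itself may depend on the graph.\<close>

theorem theorem11:
  fixes p b :: real
  assumes "0 < p" and "p < 1" and "b = 1 / (1 - p)"
  shows "\<exists>\<delta> :: nat \<Rightarrow> real. \<delta> \<in> o(\<lambda>_. 1) \<and>
    (\<lambda>n. measure_pmf.prob (gnp n p)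
       {G. \<exists>\<epsilon>. \<bar>\<epsilon>\<bar> \<le> \<delta> n \<and> real (domhad G) = (1 + \<epsilon>) * (real n / log b (real n))})
      \<longlonglongrightarrow> 1"
proof -
  define P where "P n d = measure_pmf.prob (gnp n p)
    {G. \<exists>\<epsilon>. \<bar>\<epsilon>\<bar> \<le> d \<and> real (domhad G) = (1 + \<epsilon>) * (real n / log b (real n))}" for n d
  have b1: "1 < b" using assms by simp
  have "(\<lambda>n. P n \<epsilon>) \<longlonglongrightarrow> 1" if eps: "0 < \<epsilon>" "\<epsilon> \<le> 1" for \<epsilon>
  proof -
    define M where "M n = real n / log b (real n)" for n
    define D where "D n X = real (domhad (graph_of_edges n X))" for n X
    define U where "U n = measure_pmf.prob (edge_pmf n p) {X. (1 + \<epsilon>) * M n < D n X}" for n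
    define V where "V n = measure_pmf.prob (edge_pmf n p) {X. D n X < (1 - \<epsilon>) * M n}" for n
    have "(\<lambda>n. 1 - (U n + V n)) \<longlonglongrightarrow> 1 - (0 + 0)"
      unfolding U_def V_def M_def D_def using assms eps
      by (intro tendsto_intros domhad_upper_tail domhad_lower_tail)
    then have lim: "(\<lambda>n. 1 - (U n + V n)) \<longlonglongrightarrow> 1" by simp
    have "\<forall>\<^sub>F n in sequentially. 1 - (U n + V n) \<le> P n \<epsilon>"
      using eventually_gt_at_top[of 1]
    proof eventually_elim
      case (elim n)
      let ?Q = "\<lambda>X. \<exists>e. \<bar>e\<bar> \<le> \<epsilon> \<and> D n X = (1 + e) * M n"
      have M: "0 < M n" using elim b1 by (simp add: M_def)
      have "measure_pmf.prob (edge_pmf n p) {X. \<not> ?Q X} \<le> measure_pmf.prob (edge_pmf n p)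
          ({X. (1 + \<epsilon>) * M n < D n X} \<union> {X. D n X < (1 - \<epsilon>) * M n})"
      proof (intro measure_pmf.finite_measure_mono subsetI)
        fix X assume "X \<in> {X. \<not> ?Q X}"
        then have no: "\<not> ?Q X" by simp
        \<comment> \<open>The relative error is determined by the graph as
          \<open>D n X / M n - 1\<close>; if it exceeds \<epsilon> in absolute value, the graph lies
          in one of the two tails.\<close>
        have "D n X = (1 + (D n X / M n - 1)) * M n" using M by simp
        with no have "\<not> \<bar>D n X / M n - 1\<bar> \<le> \<epsilon>" by blast
        then have "1 + \<epsilon> < D n X / M n \<or> D n X / M n < 1 - \<epsilon>" by linarith
        then show "X \<in> {X. (1 + \<epsilon>) * M n < D n X} \<union> {X. D n X < (1 - \<epsilon>) * M n}"
          using M by (simp add: pos_less_divide_eq pos_divide_less_eq)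
      qed simp
      also have "\<dots> \<le> U n + V n" unfolding U_def V_def by (intro measure_Un_le) auto
      also have "measure_pmf.prob (edge_pmf n p) {X. \<not> ?Q X} = 1 - P n \<epsilon>"
        unfolding prob_Collect_not by (simp add: P_def gnp_eq M_def D_def)
      finally show ?case by simp
    qed
    then show ?thesis
      by (intro tendsto_sandwich[OF _ _ lim tendsto_const]) (auto simp: P_def)
  qed
  then obtain \<delta> where "\<delta> \<longlonglongrightarrow> 0" "(\<lambda>n. P n (\<delta> n)) \<longlonglongrightarrow> 1"
    by (rule diagonal_tendsto[of P]) (auto simp: P_def)
  moreover from this(1) have "\<delta> \<in> o(\<lambda>_. 1)" by (intro smalloI_tendsto) auto
  ultimately show ?thesis unfolding P_def by blast
qed

end
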